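(* Let $\{X_t,t\in T\}$ be a real-valued, zero-mean, second-order stochastic process with covariance function $R$, indexed by a separable metric space $T$, let $Y$ be a random element on the same probability space, and let $\xi_1,\dots,\xi_p\in L_X^2$ be fixed. Assume: (1) $Y$ and $X$ are conditionally independent given $\xi_1,\dots,\xi_p$; (2) for any $\xi\in L_X^2$, $\mathrm{E}(\xi\mid\xi_1,\dots,\xi_p)\in\operatorname{span}\{\xi_1,\dots,\xi_p\}$ a.s.; (3) either $T$ is countable, or both $R$ is continuous on $T\times T$ and the sample paths of $\mathrm{E}(X_t\mid Y)$ are continuous on $T$ with probability 1. Then the sample paths of the process $Z_t=\mathrm{E}(X_t\mid Y)$, $t\in T$, belong to $\mathcal{H}_{X,e}=\operatorname{span}\{\Psi_X(\xi_1),\dots,\Psi_X(\xi_p)\}$ almost surely.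
   Context: All random quantities are defined on a probability space $(\Omega,\mathcal{A},P)$. $R(s,t)=\mathrm{E}(X_sX_t)$. $L_X^2$ is the closed linear span of $\{X_t,t\in T\}$ in $L^2(\Omega,\mathcal{A},P)$, with inner product $\langle U,V\rangle=\mathrm{E}(UV)$. $\mathcal{H}_R$ is the reproducing kernel Hilbert space of functions on $T$ with reproducing kernel $R$. $\Psi_X:L_X^2\to\mathcal{H}_R$ is the isometric isomorphism determined by $\Psi_X(X_t)=R(\cdot,t)$, $t\in T$ (Loève's isometry). *)

theory Defs
  imports "HOL-Probability.Probability" "HOL-Library.Function_Algebras"
begin

global_interpretation fun_space: vector_space "\<lambda>(c::real) (f::'b \<Rightarrow> real) x. c * f x"
  by standard (auto simp: fun_eq_iff algebra_simps)

definition gen_subalgebra :: "'a measure \<Rightarrow> 'i set \<Rightarrow> ('i \<Rightarrow> 'a \<Rightarrow> real) \<Rightarrow> 'a measure" where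
  "gen_subalgebra M I f =
     sigma (space M) {f i -` B \<inter> space M | i B. i \<in> I \<and> B \<in> sets borel}"

definition cond_exp_version :: "'a measure \<Rightarrow> 'a measure \<Rightarrow> ('a \<Rightarrow> real) \<Rightarrow> ('a \<Rightarrow> real) \<Rightarrow> bool" where
  "cond_exp_version M F f g \<longleftrightarrow>
     g \<in> borel_measurable F \<and> (AE \<omega> in M. g \<omega> = real_cond_exp M F f \<omega>)"

definition cond_indep :: "'a measure \<Rightarrow> 'a measure \<Rightarrow> 'a measure \<Rightarrow> 'a measure \<Rightarrow> bool" where
  "cond_indep M F1 F2 G \<longleftrightarrow>
     (\<forall>A \<in> sets F1. \<forall>B \<in> sets F2. AE \<omega> in M.
        real_cond_exp M G (indicator (A \<inter> B)) \<omega> =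
          real_cond_exp M G (indicator A) \<omega> * real_cond_exp M G (indicator B) \<omega>)"

(* Elements of L^2 are represented by functions; the set below is closed under
   almost sure modification. *)
definition L2_span :: "'a measure \<Rightarrow> ('t \<Rightarrow> 'a \<Rightarrow> real) \<Rightarrow> ('a \<Rightarrow> real) set" where
  "L2_span M X =
     {U \<in> borel_measurable M. integrable M (\<lambda>\<omega>. (U \<omega>)\<^sup>2) \<and>
        (\<forall>\<epsilon>>0. \<exists>V \<in> fun_space.span (range X). (\<integral>\<omega>. (U \<omega> - V \<omega>)\<^sup>2 \<partial>M) < \<epsilon>)}"

(* H with inner product ip is the Hilbert space of functions with reproducing kernel K.
   Completeness is phrased with the squared norm ip f f. *)
locale rkhs =
  fixes H :: "('t \<Rightarrow> real) set"
    and ip :: "('t \<Rightarrow> real) \<Rightarrow> ('t \<Rightarrow> real) \<Rightarrow> real"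
    and K :: "'t \<Rightarrow> 't \<Rightarrow> real"
  assumes subspace: "fun_space.subspace H"
    and ip_commute: "f \<in> H \<Longrightarrow> g \<in> H \<Longrightarrow> ip f g = ip g f"
    and ip_add_left: "f \<in> H \<Longrightarrow> g \<in> H \<Longrightarrow> h \<in> H \<Longrightarrow> ip (\<lambda>t. f t + g t) h = ip f h + ip g h"
    and ip_scale_left: "f \<in> H \<Longrightarrow> g \<in> H \<Longrightarrow> ip (\<lambda>t. c * f t) g = c * ip f g"
    and ip_nonneg: "f \<in> H \<Longrightarrow> 0 \<le> ip f f"
    and ip_definite: "f \<in> H \<Longrightarrow> ip f f = 0 \<Longrightarrow> f = (\<lambda>t. 0)"
    and complete:
      "(\<And>n. u n \<in> H) \<Longrightarrow>
       (\<And>\<epsilon>. \<epsilon> > 0 \<Longrightarrow> \<exists>N. \<forall>m\<ge>N. \<forall>n\<ge>N. ip (\<lambda>t. u m t - u n t) (\<lambda>t. u m t - u n t) < \<epsilon>) \<Longrightarrow>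
       \<exists>f\<in>H. (\<lambda>n. ip (\<lambda>t. u n t - f t) (\<lambda>t. u n t - f t)) \<longlonglongrightarrow> 0"
    and kernel_mem: "(\<lambda>s. K s t) \<in> H"
    and reproducing: "f \<in> H \<Longrightarrow> ip f (\<lambda>s. K s t) = f t"

(* An isometric isomorphism of L2_span M X onto (H, ip) with X t \<mapsto> K(., t).
   Preservation of the inner product makes \<Psi> injective up to almost sure equality
   and constant on almost sure equivalence classes. *)
definition loeve_isometry ::
    "'a measure \<Rightarrow> ('t \<Rightarrow> 'a \<Rightarrow> real) \<Rightarrow> ('t \<Rightarrow> real) set \<Rightarrow>
     (('t \<Rightarrow> real) \<Rightarrow> ('t \<Rightarrow> real) \<Rightarrow> real) \<Rightarrow> ('t \<Rightarrow> 't \<Rightarrow> real) \<Rightarrow>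
     (('a \<Rightarrow> real) \<Rightarrow> ('t \<Rightarrow> real)) \<Rightarrow> bool" where
  "loeve_isometry M X H ip K \<Psi> \<longleftrightarrow>
     \<Psi> ` L2_span M X = H \<and>
     (\<forall>U \<in> L2_span M X. \<forall>V \<in> L2_span M X. \<forall>a b.
        \<Psi> (\<lambda>\<omega>. a * U \<omega> + b * V \<omega>) = (\<lambda>t. a * \<Psi> U t + b * \<Psi> V t)) \<and>
     (\<forall>U \<in> L2_span M X. \<forall>V \<in> L2_span M X. ip (\<Psi> U) (\<Psi> V) = (\<integral>\<omega>. U \<omega> * V \<omega> \<partial>M)) \<and>
     (\<forall>t. \<Psi> (X t) = (\<lambda>s. K s t))"

end

theory Submission
  imports Defs
begin

text \<open>
  Conditional independence lets the regression on \<open>Y\<close> pass through the \<open>\<xi>\<close>'s: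
  \[ E(X_t | Y) = E(E(X_t | \xi) | Y) \quad\mbox{almost surely} \]
  (\<open>cond_indep_tower\<close>). By linearity of the conditional expectations, \<open>E(X\<^sub>t | \<xi>)\<close> lies in the
  span of the \<open>\<xi>\<close>'s, and being a conditional expectation it is the orthogonal projection of
  \<open>X\<^sub>t\<close> onto that span. Let \<open>e\<^sub>1, \<dots>, e\<^sub>q\<close> be an orthonormal basis of
  the span (\<open>gram_schmidt_ae\<close>). The coordinates of the projection are \<open>E(X\<^sub>t e\<^sub>j)\<close>, and
  Loeve's isometry together with the reproducing property turns them into function values:
  \[ E(X_t e_j) = \langle \Psi e_j, R(\cdot,t) \rangle = (\Psi e_j)(t). \]
  Hence for every \<open>t\<close>, almost surely,
  \[ Z_t = \sum_{j=1}^q E(e_j | Y) \, (\Psi e_j)(t). \]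
  For fixed \<open>\<omega>\<close> the right-hand side is, as a function of \<open>t\<close>, a linear combination of the
  \<open>\<Psi> e\<^sub>j\<close>, each of which lies in the span of the \<open>\<Psi> \<xi>\<^sub>i\<close>.

  The exceptional null set still depends on \<open>t\<close>. If \<open>T\<close> is countable, the union of these null
  sets is null. If \<open>R\<close> is continuous, so is every function of the reproducing kernel
  Hilbert space (\<open>rkhs_continuous_on\<close>); both sides are then continuous in \<open>t\<close>, and equality on
  a countable dense set of indices gives equality everywhere.
\<close>

section \<open>Square-integrable functions and orthonormal families\<close>
definition square_integrable :: "'a measure \<Rightarrow> ('a \<Rightarrow> real) \<Rightarrow> bool" where
  "square_integrable M f \<longleftrightarrow> f \<in> borel_measurable M \<and> integrable M (\<lambda>\<omega>. (f \<omega>)\<^sup>2)"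

definition orthonormal_in :: "'a measure \<Rightarrow> ('a \<Rightarrow> real) set \<Rightarrow> bool" where
  "orthonormal_in M E \<longleftrightarrow>
     (\<forall>e\<in>E. square_integrable M e) \<and>
     (\<forall>e\<in>E. \<forall>f\<in>E. (\<integral>\<omega>. e \<omega> * f \<omega> \<partial>M) = (if e = f then 1 else 0))"

lemma square_integrable_measurable [measurable_dest]:
  "square_integrable M f \<Longrightarrow> f \<in> borel_measurable M"
  by (simp add: square_integrable_def)

lemma square_integrable_mult:
  assumes f: "square_integrable M f" and g: "square_integrable M g"
  shows "integrable M (\<lambda>\<omega>. f \<omega> * g \<omega>)"
proof (rule Bochner_Integration.integrable_bound)
  show "integrable M (\<lambda>\<omega>. (f \<omega>)\<^sup>2 + (g \<omega>)\<^sup>2)"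
    using f g by (simp add: square_integrable_def)
  show "(\<lambda>\<omega>. f \<omega> * g \<omega>) \<in> borel_measurable M"
    using f g by (auto simp: square_integrable_def)
  have "\<bar>a * b\<bar> \<le> a\<^sup>2 + b\<^sup>2" for a b :: real
    using sum_squares_bound[of "\<bar>a\<bar>" "\<bar>b\<bar>"] mult_nonneg_nonneg[of "\<bar>a\<bar>" "\<bar>b\<bar>"]
    unfolding abs_mult power2_abs by linarith
  then show "AE \<omega> in M. norm (f \<omega> * g \<omega>) \<le> norm ((f \<omega>)\<^sup>2 + (g \<omega>)\<^sup>2)"
    by simp
qed

lemma square_integrable_lincomb:
  assumes f: "square_integrable M f" and g: "square_integrable M g"
  shows "square_integrable M (\<lambda>\<omega>. a * f \<omega> + b * g \<omega>)"
proof -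
  have "(\<lambda>\<omega>. (a * f \<omega> + b * g \<omega>)\<^sup>2) =
      (\<lambda>\<omega>. a\<^sup>2 * (f \<omega>)\<^sup>2 + 2 * a * b * (f \<omega> * g \<omega>) + b\<^sup>2 * (g \<omega>)\<^sup>2)"
    by (auto simp: power2_eq_square algebra_simps)
  then show ?thesis
    using f g square_integrable_mult[OF f g] by (auto simp: square_integrable_def)
qed

lemma square_integrable_zero: "square_integrable M (\<lambda>\<omega>. 0)"
  by (simp add: square_integrable_def)

lemma sum_fun_apply: "sum f A x = (\<Sum>a\<in>A. f a x)"
  for f :: "'i \<Rightarrow> 'a \<Rightarrow> 'b::comm_monoid_add"
  by (induction A rule: infinite_finite_induct) auto

lemma square_integrable_span:
  assumes "\<And>s. s \<in> S \<Longrightarrow> square_integrable M s" and "f \<in> fun_space.span S"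
  shows "square_integrable M f"
  using assms(2)
proof (induction rule: fun_space.span_induct_alt)
  case base
  then show ?case using square_integrable_zero by (simp add: zero_fun_def)
next
  case (step c x y)
  then show ?case
    using square_integrable_lincomb[OF assms(1)[OF step(1)] step(2), of c 1]
    by (simp add: plus_fun_def)
qed

lemma (in finite_measure) square_integrable_integrable:
  assumes "square_integrable M f"
  shows "integrable M f"
  using square_integrable_mult[OF assms, of "\<lambda>_. 1"] by (simp add: square_integrable_def)

lemma orthonormal_in_coefficient:
  assumes "finite E" "orthonormal_in M E" "f \<in> E"
  shows "(\<integral>\<omega>. (\<Sum>e\<in>E. c e * e \<omega>) * f \<omega> \<partial>M) = c f"
proof -
  have int: "integrable M (\<lambda>\<omega>. e \<omega> * f \<omega>)" if "e \<in> E" for e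
    using assms that by (auto simp: orthonormal_in_def intro: square_integrable_mult)
  have "(\<integral>\<omega>. (\<Sum>e\<in>E. c e * e \<omega>) * f \<omega> \<partial>M) = (\<integral>\<omega>. (\<Sum>e\<in>E. c e * (e \<omega> * f \<omega>)) \<partial>M)"
    by (simp add: sum_distrib_right mult.assoc)
  also have "\<dots> = (\<Sum>e\<in>E. c e * (\<integral>\<omega>. e \<omega> * f \<omega> \<partial>M))"
    using int by (simp add: Bochner_Integration.integral_sum)
  also have "\<dots> = (\<Sum>e\<in>E. if e = f then c f else 0)"
    using assms(2,3) by (intro sum.cong) (auto simp: orthonormal_in_def)
  finally show ?thesis using assms(1,3) by simp
qed

text \<open>
  The Gram--Schmidt process, modulo null sets. The functions themselves may be linearly
  independent while their almost sure classes are not; a remainder of norm zero is therefore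
  dropped, and the given functions are recovered only almost surely.
\<close>
lemma gram_schmidt_ae:
  assumes "finite S" "\<And>s. s \<in> S \<Longrightarrow> square_integrable M s"
  shows "\<exists>E. finite E \<and> E \<subseteq> fun_space.span S \<and> orthonormal_in M E \<and>
           (\<forall>x\<in>S. \<exists>c. AE \<omega> in M. x \<omega> = (\<Sum>e\<in>E. c e * e \<omega>))"
  using assms
proof (induction S rule: finite_induct)
  case empty
  then show ?case by (intro exI[of _ "{}"]) (simp add: orthonormal_in_def)
next
  case (insert x S)
  then obtain E where E: "finite E" "E \<subseteq> fun_space.span S" "orthonormal_in M E"
    and cover: "\<And>y. y \<in> S \<Longrightarrow> \<exists>c. AE \<omega> in M. y \<omega> = (\<Sum>e\<in>E. c e * e \<omega>)"
    by auto
  \<comment> \<open>Split \<open>x\<close> into its projection \<open>pr\<close> onto the span of \<open>E\<close> and the remainder \<open>r\<close>.\<close>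
  define b where "b e = (\<integral>\<omega>. x \<omega> * e \<omega> \<partial>M)" for e
  define pr where "pr = (\<lambda>\<omega>. \<Sum>e\<in>E. b e * e \<omega>)"
  define r where "r = (\<lambda>\<omega>. x \<omega> - pr \<omega>)"
  define n where "n = (\<integral>\<omega>. (r \<omega>)\<^sup>2 \<partial>M)"
  have xL: "square_integrable M x" using insert.prems by simp
  have E_span: "E \<subseteq> fun_space.span (insert x S)"
    using E(2) fun_space.span_mono[of S "insert x S"] by auto
  have "pr = (\<Sum>e\<in>E. (\<lambda>\<omega>. b e * e \<omega>))" by (auto simp: pr_def sum_fun_apply)
  then have pr_span: "pr \<in> fun_space.span (insert x S)"
    using E_span by (auto intro!: fun_space.span_sum fun_space.span_scale)
  have "r = x - pr" by (auto simp: r_def)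
  then have r_span: "r \<in> fun_space.span (insert x S)"
    using pr_span fun_space.span_base[of x "insert x S"] by (simp add: fun_space.span_diff)
  have L: "square_integrable M f" if "f \<in> fun_space.span (insert x S)" for f
    using square_integrable_span[OF insert.prems that] by blast
  have prL: "square_integrable M pr" and rL: "square_integrable M r"
    using L pr_span r_span by auto
  have orth: "(\<integral>\<omega>. r \<omega> * e \<omega> \<partial>M) = 0" if e: "e \<in> E" for e
  proof -
    have eL: "square_integrable M e" using e E_span L by blast
    have "(\<integral>\<omega>. r \<omega> * e \<omega> \<partial>M) = (\<integral>\<omega>. x \<omega> * e \<omega> \<partial>M) - (\<integral>\<omega>. pr \<omega> * e \<omega> \<partial>M)"
      unfolding r_def left_diff_distrib
      by (intro Bochner_Integration.integral_diff square_integrable_mult xL prL eL)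
    also have "(\<integral>\<omega>. pr \<omega> * e \<omega> \<partial>M) = b e"
      unfolding pr_def by (rule orthonormal_in_coefficient[OF E(1,3) e])
    finally show ?thesis by (simp add: b_def)
  qed
  show ?case
  proof (cases "n = 0")
    case True
    then have "AE \<omega> in M. (r \<omega>)\<^sup>2 = 0"
      using rL integral_nonneg_eq_0_iff_AE[of M "\<lambda>\<omega>. (r \<omega>)\<^sup>2"]
      by (simp add: n_def square_integrable_def)
    then have "AE \<omega> in M. x \<omega> = (\<Sum>e\<in>E. b e * e \<omega>)"
      by eventually_elim (simp add: r_def pr_def)
    then show ?thesis
      using E E_span cover by (intro exI[of _ E]) auto
  next
    case False
    moreover have "n \<ge> 0" by (simp add: n_def)
    ultimately have n: "n > 0" by simp
    define u where "u = (\<lambda>\<omega>. 1 / sqrt n * r \<omega>)"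
    have u_span: "u \<in> fun_space.span (insert x S)"
      unfolding u_def by (rule fun_space.span_scale[OF r_span])
    have uu: "(\<integral>\<omega>. u \<omega> * u \<omega> \<partial>M) = 1"
    proof -
      have "(\<lambda>\<omega>. u \<omega> * u \<omega>) = (\<lambda>\<omega>. 1 / n * (r \<omega>)\<^sup>2)"
        using n by (auto simp: u_def power2_eq_square)
      then show ?thesis using n by (simp add: n_def[symmetric])
    qed
    have ue: "(\<integral>\<omega>. u \<omega> * e \<omega> \<partial>M) = 0" if "e \<in> E" for e
      using orth[OF that] by (simp add: u_def)
    then have eu: "(\<integral>\<omega>. e \<omega> * u \<omega> \<partial>M) = 0" if "e \<in> E" for e
      using that by (simp add: mult.commute)
    \<comment> \<open>\<open>u\<close> is orthogonal to \<open>E\<close>, so if it were in \<open>E\<close> it would be orthogonal to itself.\<close>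
    have "u \<notin> E" using ue uu by fastforce
    have "orthonormal_in M (insert u E)"
      using E(3) L[OF u_span] uu ue eu \<open>u \<notin> E\<close> by (auto simp: orthonormal_in_def)
    moreover have "\<exists>c. AE \<omega> in M. y \<omega> = (\<Sum>e\<in>insert u E. c e * e \<omega>)"
      if y: "y \<in> insert x S" for y
    proof (cases "y = x")
      case True
      have "x \<omega> = (\<Sum>e\<in>insert u E. (b(u := sqrt n)) e * e \<omega>)" for \<omega>
      proof -
        have "(\<Sum>e\<in>E. (b(u := sqrt n)) e * e \<omega>) = pr \<omega>"
          unfolding pr_def using \<open>u \<notin> E\<close> by (intro sum.cong) auto
        then show ?thesis
          using E(1) \<open>u \<notin> E\<close> n by (simp add: u_def r_def)
      qed
      then show ?thesis using True by (intro exI[of _ "b(u := sqrt n)"]) simp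
    next
      case False
      then obtain c where c: "AE \<omega> in M. y \<omega> = (\<Sum>e\<in>E. c e * e \<omega>)"
        using y cover by auto
      have "(\<Sum>e\<in>insert u E. (c(u := 0)) e * e \<omega>) = (\<Sum>e\<in>E. c e * e \<omega>)" for \<omega>
      proof -
        have "(\<Sum>e\<in>E. (c(u := 0)) e * e \<omega>) = (\<Sum>e\<in>E. c e * e \<omega>)"
          using \<open>u \<notin> E\<close> by (intro sum.cong) auto
        then show ?thesis using E(1) \<open>u \<notin> E\<close> by simp
      qed
      then show ?thesis using c by (intro exI[of _ "c(u := 0)"]) simp
    qed
    ultimately show ?thesis
      using E(1) E_span u_span by (intro exI[of _ "insert u E"]) auto
  qed
qed

lemma span_ae_expansion:
  assumes "\<And>s. s \<in> S \<Longrightarrow> \<exists>c. AE \<omega> in M. s \<omega> = (\<Sum>e\<in>E. c e * e \<omega> :: real)"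
    and "x \<in> fun_space.span S"
  shows "\<exists>c. AE \<omega> in M. x \<omega> = (\<Sum>e\<in>E. c e * e \<omega>)"
  using assms(2)
proof (induction rule: fun_space.span_induct_alt)
  case base
  show ?case by (intro exI[of _ "\<lambda>_. 0"]) simp
next
  case (step a s y)
  obtain c d where c: "AE \<omega> in M. s \<omega> = (\<Sum>e\<in>E. c e * e \<omega>)"
    and d: "AE \<omega> in M. y \<omega> = (\<Sum>e\<in>E. d e * e \<omega>)"
    using assms(1)[OF step(1)] step(2) by blast
  from c d have "AE \<omega> in M. ((\<lambda>\<omega>. a * s \<omega>) + y) \<omega> = (\<Sum>e\<in>E. (a * c e + d e) * e \<omega>)"
    by eventually_elim (simp add: sum.distrib sum_distrib_left algebra_simps)
  then show ?case by (intro exI[of _ "\<lambda>e. a * c e + d e"])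
qed

section \<open>The closed linear span and Loeve's isometry\<close>
lemma L2_span_square_integrable: "U \<in> L2_span M X \<Longrightarrow> square_integrable M U"
  by (simp add: L2_span_def square_integrable_def)

lemma generator_in_L2_span:
  assumes "square_integrable M (X t)"
  shows "X t \<in> L2_span M X"
  using assms
  by (auto simp: L2_span_def square_integrable_def intro!: bexI[of _ "X t"] fun_space.span_base)

lemma L2_span_lincomb:
  assumes X: "\<And>t. square_integrable M (X t)"
    and U: "U \<in> L2_span M X" and V: "V \<in> L2_span M X"
  shows "(\<lambda>\<omega>. a * U \<omega> + b * V \<omega>) \<in> L2_span M X"
proof -
  have UL: "square_integrable M U" and VL: "square_integrable M V"
    using U V by (auto intro: L2_span_square_integrable)
  have "\<exists>W \<in> fun_space.span (range X). (\<integral>\<omega>. (a * U \<omega> + b * V \<omega> - W \<omega>)\<^sup>2 \<partial>M) < \<epsilon>"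
    if \<epsilon>: "\<epsilon> > 0" for \<epsilon>
  proof -
    \<comment> \<open>From \<open>(x + y)\<^sup>2 \<le> 2 x\<^sup>2 + 2 y\<^sup>2\<close>; the summand 1 keeps \<open>C\<close> positive when \<open>a = b = 0\<close>.\<close>
    define C where "C = 2 * a\<^sup>2 + 2 * b\<^sup>2 + 1"
    have C: "C > 0" by (simp add: C_def add_nonneg_pos)
    have "\<epsilon> / C > 0" using \<epsilon> C by simp
    obtain U' where U': "U' \<in> fun_space.span (range X)" "(\<integral>\<omega>. (U \<omega> - U' \<omega>)\<^sup>2 \<partial>M) < \<epsilon> / C"
      using U \<open>\<epsilon> / C > 0\<close> unfolding L2_span_def by blast
    obtain V' where V': "V' \<in> fun_space.span (range X)" "(\<integral>\<omega>. (V \<omega> - V' \<omega>)\<^sup>2 \<partial>M) < \<epsilon> / C"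
      using V \<open>\<epsilon> / C > 0\<close> unfolding L2_span_def by blast
    have U'L: "square_integrable M U'" and V'L: "square_integrable M V'"
      using square_integrable_span[OF _ U'(1)] square_integrable_span[OF _ V'(1)] X by blast+
    have dU: "square_integrable M (\<lambda>\<omega>. U \<omega> - U' \<omega>)"
      using square_integrable_lincomb[OF UL U'L, of 1 "-1"] by simp
    have dV: "square_integrable M (\<lambda>\<omega>. V \<omega> - V' \<omega>)"
      using square_integrable_lincomb[OF VL V'L, of 1 "-1"] by simp
    define W where "W = (\<lambda>\<omega>. a * U' \<omega>) + (\<lambda>\<omega>. b * V' \<omega>)"
    have W: "W \<in> fun_space.span (range X)"
      unfolding W_def by (intro fun_space.span_add fun_space.span_scale U' V')
    have eq: "(\<lambda>\<omega>. a * U \<omega> + b * V \<omega> - W \<omega>) =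
        (\<lambda>\<omega>. a * (U \<omega> - U' \<omega>) + b * (V \<omega> - V' \<omega>))"
      by (auto simp: W_def algebra_simps)
    have bound: "(a * x + b * y)\<^sup>2 \<le> 2 * a\<^sup>2 * x\<^sup>2 + 2 * b\<^sup>2 * y\<^sup>2" for x y
      using sum_squares_bound[of "a * x" "b * y"] by (simp add: power2_sum power_mult_distrib)
    have "(\<integral>\<omega>. (a * U \<omega> + b * V \<omega> - W \<omega>)\<^sup>2 \<partial>M)
        = (\<integral>\<omega>. (a * (U \<omega> - U' \<omega>) + b * (V \<omega> - V' \<omega>))\<^sup>2 \<partial>M)"
      using fun_cong[OF eq] by simp
    also have "\<dots> \<le> (\<integral>\<omega>. 2 * a\<^sup>2 * (U \<omega> - U' \<omega>)\<^sup>2 + 2 * b\<^sup>2 * (V \<omega> - V' \<omega>)\<^sup>2 \<partial>M)"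
      using square_integrable_lincomb[OF dU dV, of a b] dU dV bound
      by (intro integral_mono) (auto simp: square_integrable_def)
    also have "\<dots> = 2 * a\<^sup>2 * (\<integral>\<omega>. (U \<omega> - U' \<omega>)\<^sup>2 \<partial>M) + 2 * b\<^sup>2 * (\<integral>\<omega>. (V \<omega> - V' \<omega>)\<^sup>2 \<partial>M)"
      using dU dV by (simp add: square_integrable_def)
    also have "\<dots> \<le> 2 * a\<^sup>2 * (\<epsilon> / C) + 2 * b\<^sup>2 * (\<epsilon> / C)"
      using U'(2) V'(2) by (intro add_mono mult_left_mono) auto
    also have "\<dots> < C * (\<epsilon> / C)"
      unfolding distrib_right[symmetric]
      by (rule mult_strict_right_mono) (use \<open>\<epsilon> / C > 0\<close> in \<open>simp_all add: C_def\<close>)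
    also have "\<dots> = \<epsilon>" using C by simp
    finally show ?thesis using W by blast
  qed
  moreover have "square_integrable M (\<lambda>\<omega>. a * U \<omega> + b * V \<omega>)"
    using UL VL by (rule square_integrable_lincomb)
  ultimately show ?thesis by (simp add: L2_span_def square_integrable_def)
qed

text \<open>
  The isometry is linear only on the closed span, so that membership of the intermediate
  combinations has to be carried along in the induction.
\<close>
lemma loeve_isometry_span:
  assumes X: "\<And>t. square_integrable M (X t)"
    and \<Psi>: "loeve_isometry M X H ip K \<Psi>"
    and S: "S \<subseteq> L2_span M X" and f: "f \<in> fun_space.span S"
  shows "f \<in> L2_span M X \<and> \<Psi> f \<in> fun_space.span (\<Psi> ` S)"
  using f
proof (induction rule: fun_space.span_induct_alt)
  case base
  \<comment> \<open>The zero function is written as a trivial combination of some \<open>X t\<close> to make linearity applicable.\<close>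
  have lin: "\<Psi> (\<lambda>\<omega>. 0 * X t \<omega> + 0 * X t \<omega>) = (\<lambda>s. 0 * \<Psi> (X t) s + 0 * \<Psi> (X t) s)" for t
    using \<Psi> generator_in_L2_span[of M X t, OF X] unfolding loeve_isometry_def by blast
  have "(\<lambda>\<omega>. 0 * X t \<omega> + 0 * X t \<omega>) \<in> L2_span M X" for t
    using L2_span_lincomb[of M X, OF X generator_in_L2_span[of M X t, OF X] generator_in_L2_span[of M X t, OF X]] .
  then show ?case
    using lin fun_space.span_zero[of "\<Psi> ` S"] by (simp add: zero_fun_def)
next
  case (step c s f)
  have eq: "(\<lambda>\<omega>. c * s \<omega>) + f = (\<lambda>\<omega>. c * s \<omega> + 1 * f \<omega>)" by auto
  have "\<Psi> (\<lambda>\<omega>. c * s \<omega> + 1 * f \<omega>) = (\<lambda>t. c * \<Psi> s t + 1 * \<Psi> f t)"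
    using \<Psi> S step(1,2) unfolding loeve_isometry_def by blast
  also have "\<dots> = (\<lambda>t. c * \<Psi> s t) + \<Psi> f" by auto
  also have "\<dots> \<in> fun_space.span (\<Psi> ` S)"
    using step by (intro fun_space.span_add fun_space.span_scale) (auto intro: fun_space.span_base)
  finally show ?case
    unfolding eq using L2_span_lincomb[of M X s f c 1, OF X] step S by auto
qed

section \<open>Continuity in a reproducing kernel Hilbert space\<close>
context rkhs
begin

lemma ip_lincomb_left:
  assumes "f \<in> H" "g \<in> H" "h \<in> H"
  shows "ip (\<lambda>t. f t + c * g t) h = ip f h + c * ip g h"
  using assms ip_add_left[of f "\<lambda>t. c * g t" h] ip_scale_left[of g h c]
    fun_space.subspace_scale[OF subspace, of g, where c = c] by simp

lemma lincomb_mem: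
  assumes "f \<in> H" "g \<in> H"
  shows "(\<lambda>t. f t + c * g t) \<in> H"
  using fun_space.subspace_add[OF subspace assms(1) fun_space.subspace_scale[OF subspace assms(2), where c = c]]
  by (simp add: plus_fun_def)

lemma ip_lincomb_self:
  assumes f: "f \<in> H" and g: "g \<in> H"
  shows "ip (\<lambda>t. f t + c * g t) (\<lambda>t. f t + c * g t) = ip f f + 2 * c * ip f g + c\<^sup>2 * ip g g"
proof -
  let ?h = "\<lambda>t. f t + c * g t"
  have "ip ?h ?h = ip ?h f + c * ip ?h g"
    using f g ip_lincomb_left[OF f g lincomb_mem[OF f g]]
      ip_commute[OF f lincomb_mem[OF f g]] ip_commute[OF g lincomb_mem[OF f g]] by simp
  then show ?thesis
    using f g ip_commute[OF f g] by (simp add: ip_lincomb_left power2_eq_square algebra_simps)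
qed

text \<open>
  Nonnegativity of the squared norm of \<open>f - c g\<close> at its minimising \<open>c = ip f g / ip g g\<close>.
\<close>
lemma ip_Cauchy_Schwarz:
  assumes f: "f \<in> H" and g: "g \<in> H"
  shows "(ip f g)\<^sup>2 \<le> ip f f * ip g g"
proof (cases "ip g g = 0")
  case True
  then have "g = (\<lambda>t. 0 * g t)" using ip_definite[OF g] by simp
  then have "ip g f = 0" using ip_scale_left[OF g f, of 0] by simp
  then show ?thesis using True ip_commute[OF f g] by simp
next
  case False
  then have gg: "ip g g > 0" using ip_nonneg[OF g] by simp
  have "0 \<le> ip f f + 2 * (- ip f g / ip g g) * ip f g + (- ip f g / ip g g)\<^sup>2 * ip g g"
    using ip_lincomb_self[OF f g] ip_nonneg[OF lincomb_mem[OF f g]] by metis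
  also have "\<dots> = ip f f - (ip f g)\<^sup>2 / ip g g"
    using gg by (simp add: power2_eq_square field_simps)
  finally show ?thesis using gg by (simp add: field_simps)
qed

text \<open>
  Apply the Cauchy--Schwarz inequality to \<open>f s - f t = ip f (K(\<cdot>, s) - K(\<cdot>, t))\<close>; the last factor
  on the right is the squared norm of the kernel difference, so the modulus of continuity of \<open>f\<close>
  is controlled by \<open>K\<close> alone.
\<close>
lemma increment_bound:
  assumes f: "f \<in> H"
  shows "(f s - f t)\<^sup>2 \<le> ip f f * (K s s - 2 * K s t + K t t)"
proof -
  define k where "k t = (\<lambda>s. K s t)" for t
  have k: "k t \<in> H" and rep: "h \<in> H \<Longrightarrow> ip h (k t) = h t" for t h
    using kernel_mem reproducing by (auto simp: k_def)
  let ?d = "\<lambda>x. k s x + (-1) * k t x"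
  have "ip f ?d = f s - f t"
    using ip_lincomb_left[OF k k f, of s "-1" t] ip_commute[OF f lincomb_mem[OF k k], of s "-1" t]
      ip_commute[OF f k] rep[OF f] by simp
  moreover have "ip ?d ?d = K s s - 2 * K s t + K t t"
  proof -
    have kk: "ip (k a) (k b) = K b a" for a b using rep[OF k] by (simp add: k_def)
    have "ip (k s) (k t) = K s t" using ip_commute[OF k k, of s t] kk by simp
    then show ?thesis using ip_lincomb_self[OF k k, of s "-1" t] kk by simp
  qed
  ultimately show ?thesis
    using ip_Cauchy_Schwarz[OF f lincomb_mem[OF k k], of s "-1" t] by simp
qed

end

lemma rkhs_continuous_on:
  fixes K :: "'t::metric_space \<Rightarrow> 't \<Rightarrow> real"
  assumes "rkhs H ip K" and K: "continuous_on UNIV (\<lambda>(s, t). K s t)" and f: "f \<in> H"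
  shows "continuous_on UNIV f"
proof -
  interpret rkhs H ip K by fact
  have "(f \<longlongrightarrow> f t) (at t)" for t
  proof -
    have cont: "((\<lambda>s. K (g s) (h s)) \<longlongrightarrow> K (g t) (h t)) (at t)"
      if "(g \<longlongrightarrow> g t) (at t)" "(h \<longlongrightarrow> h t) (at t)" for g h
    proof -
      have "isCont (\<lambda>(s, t). K s t) (g t, h t)"
        using K by (simp add: continuous_on_eq_continuous_at)
      from isCont_tendsto_compose[OF this tendsto_Pair[OF that]] show ?thesis by simp
    qed
    have "((\<lambda>s. ip f f * (K s s - 2 * K s t + K t t)) \<longlongrightarrow> ip f f * (K t t - 2 * K t t + K t t)) (at t)"
      by (intro tendsto_intros cont)
    then have "((\<lambda>s. ip f f * (K s s - 2 * K s t + K t t)) \<longlongrightarrow> 0) (at t)" by simp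
    then have "((\<lambda>s. (f s - f t)\<^sup>2) \<longlongrightarrow> 0) (at t)"
      by (rule tendsto_sandwich[OF _ _ tendsto_const, rotated 2]) (auto simp: increment_bound[OF f])
    then have "((\<lambda>s. f s - f t) \<longlongrightarrow> 0) (at t)"
      by (simp add: power_tendsto_0_iff)
    then show ?thesis by (simp add: LIM_zero_iff)
  qed
  then show ?thesis by (simp add: continuous_on_def)
qed

section \<open>Conditional expectation and conditional independence\<close>
lemma space_gen_subalgebra [simp]: "space (gen_subalgebra M I f) = space M"
  by (simp add: gen_subalgebra_def space_measure_of_conv)

lemma sets_gen_subalgebra:
  "sets (gen_subalgebra M I f) =
     sigma_sets (space M) {f i -` B \<inter> space M | i B. i \<in> I \<and> B \<in> sets borel}"
  unfolding gen_subalgebra_def by (rule sets_measure_of) auto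

lemma gen_subalgebra_measurable:
  assumes "i \<in> I"
  shows "f i \<in> borel_measurable (gen_subalgebra M I f)"
proof (rule measurableI)
  fix B :: "real set" assume "B \<in> sets borel"
  then have "f i -` B \<inter> space M \<in> sigma_sets (space M) {f i -` B \<inter> space M | i B. i \<in> I \<and> B \<in> sets borel}"
    using assms by (intro sigma_sets.Basic) blast
  then show "f i -` B \<inter> space (gen_subalgebra M I f) \<in> sets (gen_subalgebra M I f)"
    by (simp add: sets_gen_subalgebra)
qed auto

lemma subalgebra_gen_subalgebra:
  assumes "\<And>i. i \<in> I \<Longrightarrow> f i \<in> borel_measurable M"
  shows "subalgebra M (gen_subalgebra M I f)"
proof -
  let ?G = "{f i -` B \<inter> space M | i B. i \<in> I \<and> B \<in> sets borel}"
  have "?G \<subseteq> sets M" using assms by auto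
  then show ?thesis
    by (simp add: subalgebra_def sets_gen_subalgebra sets.sigma_sets_subset)
qed

lemma borel_measurable_span:
  assumes "\<And>s. s \<in> S \<Longrightarrow> s \<in> borel_measurable F" and "f \<in> fun_space.span S"
  shows "f \<in> borel_measurable F"
  using assms(2)
proof (induction rule: fun_space.span_induct_alt)
  case base
  then show ?case by (simp add: zero_fun_def)
next
  case (step c x y)
  then show ?case using assms(1)[OF step(1)] by (simp add: plus_fun_def)
qed

lemma (in prob_space) prob_sigma_finite_subalgebra:
  "subalgebra M F \<Longrightarrow> sigma_finite_subalgebra M F"
  by (intro finite_measure_subalgebra_is_sigma_finite)
    (simp add: finite_measure_subalgebra_def finite_measure_subalgebra_axioms_def finite_measure_axioms)

text \<open>
  For \<open>A\<close> in \<open>F1\<close> put \<open>g = E(1\<^sub>A | G)\<close>. Integrating the product rule for conditional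
  probabilities shows that \<open>1\<^sub>A - g\<close> has integral zero over every set of \<open>F2\<close>, that is
  \<open>E(1\<^sub>A - g | F2) = 0\<close>. Hence \<open>1\<^sub>A - g\<close> is orthogonal to the \<open>F2\<close>-measurable function \<open>f\<close>, and as
  conditional expectation given \<open>G\<close> is self-adjoint,
  \[ E(1_A f) = E(g f) = E(g\,E(f | G)) = E(1_A E(f | G)). \]
  Conditioning the indicator on \<open>F2\<close> extends the product rule from events of \<open>F2\<close> to
  integrable \<open>f\<close> without approximating \<open>f\<close> by simple functions.
\<close>
lemma (in prob_space) cond_indep_tower:
  assumes F1: "subalgebra M F1" and F2: "subalgebra M F2" and G: "subalgebra M G"
    and ci: "cond_indep M F1 F2 G"
    and f: "integrable M f" "f \<in> borel_measurable F2"
  shows "AE \<omega> in M. real_cond_exp M F1 f \<omega> = real_cond_exp M F1 (real_cond_exp M G f) \<omega>"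
proof -
  interpret F1: sigma_finite_subalgebra M F1 by (rule prob_sigma_finite_subalgebra[OF F1])
  interpret F2: sigma_finite_subalgebra M F2 by (rule prob_sigma_finite_subalgebra[OF F2])
  interpret G: sigma_finite_subalgebra M G by (rule prob_sigma_finite_subalgebra[OF G])
  define h where "h = real_cond_exp M G f"
  have h: "integrable M h" unfolding h_def by (rule G.real_cond_exp_int(1)[OF f(1)])
  have [measurable]: "f \<in> borel_measurable M" using f(1) by simp
  have swap: "(\<integral>\<omega>\<in>A. f \<omega> \<partial>M) = (\<integral>\<omega>\<in>A. h \<omega> \<partial>M)" if A: "A \<in> sets F1" for A
  proof -
    have AM [measurable]: "A \<in> sets M" using A F1 by (auto simp: subalgebra_def)
    define a where "a = (indicator A :: 'a \<Rightarrow> real)"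
    define g where "g = real_cond_exp M G a"
    have a: "integrable M a" "a \<in> borel_measurable M"
      using integrable_real_indicator[OF AM] by (auto simp: a_def less_top[symmetric])
    have gG: "g \<in> borel_measurable G" unfolding g_def by simp
    have gi: "integrable M g" unfolding g_def by (rule G.real_cond_exp_int(1)[OF a(1)])
    have gM [measurable]: "g \<in> borel_measurable M" using gi by simp
    \<comment> \<open>Boundedness of \<open>g\<close> is what makes its products with integrable functions integrable.\<close>
    have g01: "AE \<omega> in M. \<bar>g \<omega>\<bar> \<le> 1"
    proof -
      have "AE \<omega> in M. g \<omega> \<ge> 0" unfolding g_def
        by (rule G.real_cond_exp_ge_c[OF a(1)]) (simp add: a_def)
      moreover have "AE \<omega> in M. g \<omega> \<le> 1" unfolding g_def
        by (rule G.real_cond_exp_le_c[OF a(1)]) (simp add: a_def indicator_def)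
      ultimately show ?thesis by eventually_elim simp
    qed
    have bdd_int: "integrable M (\<lambda>\<omega>. g \<omega> * k \<omega>)" if "integrable M k" for k
    proof (rule Bochner_Integration.integrable_bound[OF that])
      show "(\<lambda>\<omega>. g \<omega> * k \<omega>) \<in> borel_measurable M" using that gM by simp
      show "AE \<omega> in M. norm (g \<omega> * k \<omega>) \<le> norm (k \<omega>)"
        using g01 by eventually_elim (simp add: abs_mult mult_left_le_one_le)
    qed
    have a_int: "integrable M (\<lambda>\<omega>. a \<omega> * k \<omega>)" if "integrable M k" for k
      using integrable_mult_indicator[OF AM that] by (simp add: a_def)
    have zero: "AE \<omega> in M. real_cond_exp M F2 (\<lambda>\<omega>. a \<omega> - g \<omega>) \<omega> = 0"
    proof (rule F2.real_cond_exp_charact)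
      fix B assume B: "B \<in> sets F2"
      then have BM [measurable]: "B \<in> sets M" using F2 by (auto simp: subalgebra_def)
      define b where "b = (indicator B :: 'a \<Rightarrow> real)"
      have b: "integrable M b" "b \<in> borel_measurable M"
        using integrable_real_indicator[OF BM] by (auto simp: b_def less_top[symmetric])
      have ab: "integrable M (\<lambda>\<omega>. a \<omega> * b \<omega>)" using a_int[OF b(1)] .
      have prod: "(indicator (A \<inter> B) :: 'a \<Rightarrow> real) = (\<lambda>\<omega>. a \<omega> * b \<omega>)"
        by (auto simp: a_def b_def indicator_def)
      have "(\<integral>\<omega>. a \<omega> * b \<omega> \<partial>M) = (\<integral>\<omega>. real_cond_exp M G (\<lambda>\<omega>. a \<omega> * b \<omega>) \<omega> \<partial>M)"
        by (rule G.real_cond_exp_int(2)[OF ab, symmetric])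
      also have "\<dots> = (\<integral>\<omega>. g \<omega> * real_cond_exp M G b \<omega> \<partial>M)"
      proof (rule integral_cong_AE)
        show "AE \<omega> in M. real_cond_exp M G (\<lambda>\<omega>. a \<omega> * b \<omega>) \<omega> = g \<omega> * real_cond_exp M G b \<omega>"
          using ci[unfolded cond_indep_def, rule_format, OF A B]
          unfolding prod unfolding g_def a_def b_def .
      qed auto
      also have "\<dots> = (\<integral>\<omega>. g \<omega> * b \<omega> \<partial>M)"
        by (rule G.real_cond_exp_intg(2)[OF bdd_int[OF b(1)] gG b(2)])
      finally have "(\<integral>\<omega>. a \<omega> * b \<omega> \<partial>M) = (\<integral>\<omega>. g \<omega> * b \<omega> \<partial>M)" .
      then have "(\<integral>\<omega>. a \<omega> * b \<omega> - g \<omega> * b \<omega> \<partial>M) = 0"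
        using ab bdd_int[OF b(1)] by simp
      then show "(\<integral>\<omega>\<in>B. (a \<omega> - g \<omega>) \<partial>M) = (\<integral>\<omega>\<in>B. 0 \<partial>M)"
        unfolding set_lebesgue_integral_def by (simp add: b_def algebra_simps)
    qed (use a gi in auto)
    have "integrable M (\<lambda>\<omega>. a \<omega> * f \<omega> - g \<omega> * f \<omega>)"
      using a_int[OF f(1)] bdd_int[OF f(1)] by simp
    then have fd: "integrable M (\<lambda>\<omega>. f \<omega> * (a \<omega> - g \<omega>))" by (simp add: algebra_simps)
    have "(\<integral>\<omega>. a \<omega> * f \<omega> \<partial>M) - (\<integral>\<omega>. g \<omega> * f \<omega> \<partial>M) = (\<integral>\<omega>. a \<omega> * f \<omega> - g \<omega> * f \<omega> \<partial>M)"
      using a_int[OF f(1)] bdd_int[OF f(1)] by simp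
    also have "\<dots> = (\<integral>\<omega>. f \<omega> * (a \<omega> - g \<omega>) \<partial>M)" by (simp add: algebra_simps)
    also have "\<dots> = (\<integral>\<omega>. f \<omega> * real_cond_exp M F2 (\<lambda>\<omega>. a \<omega> - g \<omega>) \<omega> \<partial>M)"
      by (rule F2.real_cond_exp_intg(2)[OF fd f(2), symmetric]) (use a gM in auto)
    also have "\<dots> = (\<integral>\<omega>. 0 \<partial>M)"
      by (rule integral_cong_AE) (use zero in auto)
    finally have "(\<integral>\<omega>. a \<omega> * f \<omega> \<partial>M) = (\<integral>\<omega>. g \<omega> * f \<omega> \<partial>M)" by simp
    also have "\<dots> = (\<integral>\<omega>. g \<omega> * h \<omega> \<partial>M)"
      unfolding h_def by (rule G.real_cond_exp_intg(2)[OF bdd_int[OF f(1)] gG, symmetric]) simp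
    also have "\<dots> = (\<integral>\<omega>. h \<omega> * g \<omega> \<partial>M)" by (simp add: mult.commute)
    also have "\<dots> = (\<integral>\<omega>. h \<omega> * a \<omega> \<partial>M)"
      unfolding g_def
      by (rule G.real_cond_exp_intg(2)) (use a a_int[OF h] in \<open>auto simp: h_def mult.commute\<close>)
    finally show ?thesis
      unfolding set_lebesgue_integral_def by (simp add: a_def mult.commute)
  qed
  have "AE \<omega> in M. real_cond_exp M F1 f \<omega> = real_cond_exp M F1 h \<omega>"
  proof (rule F1.real_cond_exp_charact)
    show "(\<integral>\<omega>\<in>A. f \<omega> \<partial>M) = (\<integral>\<omega>\<in>A. real_cond_exp M F1 h \<omega> \<partial>M)" if "A \<in> sets F1" for A
      using swap[OF that] F1.real_cond_exp_intA[OF h that] by simp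
  qed (use f h F1.real_cond_exp_int(1) in auto)
  then show ?thesis unfolding h_def .
qed

lemma (in sigma_finite_subalgebra) real_cond_exp_lincomb:
  fixes e :: "'i \<Rightarrow> 'a \<Rightarrow> real"
  assumes "\<And>i. i \<in> I \<Longrightarrow> integrable M (e i)"
  shows "AE \<omega> in M. real_cond_exp M F (\<lambda>\<omega>. \<Sum>i\<in>I. c i * e i \<omega>) \<omega> =
           (\<Sum>i\<in>I. c i * real_cond_exp M F (e i) \<omega>)"
proof (cases "finite I")
  case False
  then show ?thesis
    using real_cond_exp_cmult[of "\<lambda>_. 0" 0] by simp
next
  case True
  then show ?thesis using assms
  proof (induction I rule: finite_induct)
    case empty
    then show ?case using real_cond_exp_cmult[of "\<lambda>_. 0" 0] by simp
  next
    case (insert i I)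
    have "integrable M (\<lambda>\<omega>. \<Sum>i\<in>I. c i * e i \<omega>)" using insert.prems by auto
    then have "AE \<omega> in M. real_cond_exp M F (\<lambda>\<omega>. c i * e i \<omega> + (\<Sum>i\<in>I. c i * e i \<omega>)) \<omega> =
        real_cond_exp M F (\<lambda>\<omega>. c i * e i \<omega>) \<omega> + real_cond_exp M F (\<lambda>\<omega>. \<Sum>i\<in>I. c i * e i \<omega>) \<omega>"
      using insert.prems by (intro real_cond_exp_add) auto
    moreover have "AE \<omega> in M. real_cond_exp M F (\<lambda>\<omega>. c i * e i \<omega>) \<omega> = c i * real_cond_exp M F (e i) \<omega>"
      using insert.prems by (intro real_cond_exp_cmult) auto
    moreover have "AE \<omega> in M. real_cond_exp M F (\<lambda>\<omega>. \<Sum>i\<in>I. c i * e i \<omega>) \<omega> =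
        (\<Sum>i\<in>I. c i * real_cond_exp M F (e i) \<omega>)"
      using insert.IH insert.prems by auto
    ultimately show ?case
      by eventually_elim (use insert.hyps in simp)
  qed
qed

section \<open>Sample paths in the finite-dimensional space\<close>
lemma separable_space_euclidean_dense:
  assumes "separable_space (euclidean :: 't::topological_space topology)"
  obtains D :: "'t::topological_space set" where "countable D" "closure D = UNIV"
  using assms by (auto simp: separable_space_def)

lemma continuous_eq_on_dense:
  fixes f g :: "'t::topological_space \<Rightarrow> 'b::real_normed_vector"
  assumes "continuous_on UNIV f" "continuous_on UNIV g" "closure D = UNIV"
    and "\<And>t. t \<in> D \<Longrightarrow> f t = g t"
  shows "f = g"
proof
  fix t
  have "continuous_on (closure D) (\<lambda>t. f t - g t)"
    using assms(1,2) by (auto intro!: continuous_intros intro: continuous_on_subset)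
  then have "f t - g t = 0"
    by (rule continuous_constant_on_closure) (use assms in auto)
  then show "f t = g t" by simp
qed

theorem theorem6:
  fixes M :: "'a measure"
    and N :: "'b measure"
    and X :: "'t::metric_space \<Rightarrow> 'a \<Rightarrow> real"
    and R :: "'t \<Rightarrow> 't \<Rightarrow> real"
    and Y :: "'a \<Rightarrow> 'b"
    and p :: nat
    and \<xi> :: "nat \<Rightarrow> 'a \<Rightarrow> real"
    and H :: "('t \<Rightarrow> real) set"
    and ip :: "('t \<Rightarrow> real) \<Rightarrow> ('t \<Rightarrow> real) \<Rightarrow> real"
    and \<Psi> :: "('a \<Rightarrow> real) \<Rightarrow> ('t \<Rightarrow> real)"
    and Z :: "'t \<Rightarrow> 'a \<Rightarrow> real"
  defines "\<sigma>Y \<equiv> vimage_algebra (space M) Y N"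
    and "\<sigma>X \<equiv> gen_subalgebra M UNIV X"
    and "\<sigma>\<xi> \<equiv> gen_subalgebra M {1..p} \<xi>"
  assumes prob: "prob_space M"
    and separable: "separable_space (euclidean :: 't topology)"
    and X_measurable: "\<And>t. X t \<in> borel_measurable M"
    and X_second_order: "\<And>t. integrable M (\<lambda>\<omega>. (X t \<omega>)\<^sup>2)"
    and X_zero_mean: "\<And>t. (\<integral>\<omega>. X t \<omega> \<partial>M) = 0"
    and R_covariance: "\<And>s t. R s t = (\<integral>\<omega>. X s \<omega> * X t \<omega> \<partial>M)"
    and RKHS: "rkhs H ip R"
    and Loeve: "loeve_isometry M X H ip R \<Psi>"
    and Y_random_element: "Y \<in> measurable M N"
    and \<xi>_mem: "\<And>i. i \<in> {1..p} \<Longrightarrow> \<xi> i \<in> L2_span M X"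
    and cond_independent: "cond_indep M \<sigma>Y \<sigma>X \<sigma>\<xi>"
    and linear_cond_exp: "\<And>\<eta>. \<eta> \<in> L2_span M X \<Longrightarrow>
          \<exists>\<zeta> \<in> fun_space.span (\<xi> ` {1..p}). AE \<omega> in M. real_cond_exp M \<sigma>\<xi> \<eta> \<omega> = \<zeta> \<omega>"
    and Z_version: "\<And>t. cond_exp_version M \<sigma>Y (X t) (Z t)"
    and countable_or_continuous:
          "countable (UNIV :: 't set) \<or>
           (continuous_on UNIV (\<lambda>(s, t). R s t) \<and>
            (AE \<omega> in M. continuous_on UNIV (\<lambda>t. Z t \<omega>)))"
  shows "AE \<omega> in M. (\<lambda>t. Z t \<omega>) \<in> fun_space.span ((\<lambda>i. \<Psi> (\<xi> i)) ` {1..p})"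
proof -
  interpret prob_space M by (rule prob)
  have XL: "square_integrable M (X t)" for t
    using X_measurable X_second_order by (simp add: square_integrable_def)
  have \<xi>L: "square_integrable M (\<xi> i)" if "i \<in> {1..p}" for i
    using L2_span_square_integrable[OF \<xi>_mem[OF that]] .
  have subY: "subalgebra M \<sigma>Y"
    using sets_image_in_sets[OF _ Y_random_element] by (simp add: \<sigma>Y_def subalgebra_def)
  have subX: "subalgebra M \<sigma>X"
    unfolding \<sigma>X_def using X_measurable by (rule subalgebra_gen_subalgebra)
  have sub\<xi>: "subalgebra M \<sigma>\<xi>"
    unfolding \<sigma>\<xi>_def using \<xi>L by (intro subalgebra_gen_subalgebra square_integrable_measurable)
  interpret Y: sigma_finite_subalgebra M \<sigma>Y by (rule prob_sigma_finite_subalgebra[OF subY])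
  interpret \<xi>: sigma_finite_subalgebra M \<sigma>\<xi> by (rule prob_sigma_finite_subalgebra[OF sub\<xi>])

  let ?S = "\<xi> ` {1..p}"
  obtain E where E: "finite E" "E \<subseteq> fun_space.span ?S" "orthonormal_in M E"
    and cover: "\<And>x. x \<in> ?S \<Longrightarrow> \<exists>c. AE \<omega> in M. x \<omega> = (\<Sum>e\<in>E. c e * e \<omega>)"
  proof -
    have "finite ?S" by simp
    moreover have "square_integrable M x" if "x \<in> ?S" for x using that \<xi>L by auto
    ultimately show ?thesis using that gram_schmidt_ae[of ?S M] by blast
  qed
  have S_sub: "?S \<subseteq> L2_span M X" using \<xi>_mem by auto
  have E_mem: "e \<in> L2_span M X" and E_\<Psi>: "\<Psi> e \<in> fun_space.span ((\<lambda>i. \<Psi> (\<xi> i)) ` {1..p})"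
    if "e \<in> E" for e
    using loeve_isometry_span[OF XL Loeve S_sub] that E(2) by (auto simp: image_image)
  have EL: "square_integrable M e" if "e \<in> E" for e
    using E_mem[OF that] by (rule L2_span_square_integrable)
  have E_\<xi>: "e \<in> borel_measurable \<sigma>\<xi>" if "e \<in> E" for e
  proof (rule borel_measurable_span)
    show "e \<in> fun_space.span ?S" using that E(2) by auto
    show "s \<in> borel_measurable \<sigma>\<xi>" if "s \<in> ?S" for s
      using that unfolding \<sigma>\<xi>_def by (auto intro: gen_subalgebra_measurable)
  qed

  have \<Psi>_eq: "\<Psi> e t = (\<integral>\<omega>. X t \<omega> * e \<omega> \<partial>M)" if e: "e \<in> E" for e t
  proof -
    have "\<Psi> e \<in> H" using Loeve E_mem[OF e] unfolding loeve_isometry_def by blast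
    then have "\<Psi> e t = ip (\<Psi> e) (\<lambda>s. R s t)" by (rule rkhs.reproducing[OF RKHS, symmetric])
    also have "\<dots> = ip (\<Psi> e) (\<Psi> (X t))" using Loeve unfolding loeve_isometry_def by simp
    also have "\<dots> = (\<integral>\<omega>. e \<omega> * X t \<omega> \<partial>M)"
      using Loeve E_mem[OF e] generator_in_L2_span[of M X t, OF XL]
      unfolding loeve_isometry_def by blast
    finally show ?thesis by (simp add: mult.commute)
  qed

  \<comment> \<open>The coefficients of the projection are tested against each \<open>e\<close>, which is measurable with
    respect to \<open>\<sigma>\<xi>\<close>, so that the conditional expectation may be replaced by \<open>X t\<close> itself.\<close>
  have regression: "AE \<omega> in M. real_cond_exp M \<sigma>\<xi> (X t) \<omega> = (\<Sum>e\<in>E. \<Psi> e t * e \<omega>)" for t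
  proof -
    obtain \<zeta> where \<zeta>: "\<zeta> \<in> fun_space.span ?S" "AE \<omega> in M. real_cond_exp M \<sigma>\<xi> (X t) \<omega> = \<zeta> \<omega>"
      using linear_cond_exp[OF generator_in_L2_span[of M X t, OF XL]] by blast
    obtain c where c: "AE \<omega> in M. \<zeta> \<omega> = (\<Sum>e\<in>E. c e * e \<omega>)"
      using span_ae_expansion[OF cover \<zeta>(1)] by blast
    from \<zeta>(2) c have ce: "AE \<omega> in M. real_cond_exp M \<sigma>\<xi> (X t) \<omega> = (\<Sum>e\<in>E. c e * e \<omega>)"
      by eventually_elim simp
    have "c e = \<Psi> e t" if e: "e \<in> E" for e
    proof -
      have [measurable]: "f \<in> borel_measurable M" if "f \<in> E" for f
        using EL[OF that] by (rule square_integrable_measurable)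
      have "c e = (\<integral>\<omega>. (\<Sum>f\<in>E. c f * f \<omega>) * e \<omega> \<partial>M)"
        by (rule orthonormal_in_coefficient[OF E(1,3) e, symmetric])
      also have "\<dots> = (\<integral>\<omega>. e \<omega> * real_cond_exp M \<sigma>\<xi> (X t) \<omega> \<partial>M)"
        by (rule integral_cong_AE) (use ce e in \<open>auto simp: mult.commute\<close>)
      also have "\<dots> = (\<integral>\<omega>. e \<omega> * X t \<omega> \<partial>M)"
        by (rule \<xi>.real_cond_exp_intg(2)[OF square_integrable_mult[OF EL[OF e] XL] E_\<xi>[OF e] X_measurable])
      finally show ?thesis using \<Psi>_eq[OF e] by (simp add: mult.commute)
    qed
    then have "(\<Sum>e\<in>E. c e * e \<omega>) = (\<Sum>e\<in>E. \<Psi> e t * e \<omega>)" for \<omega> by simp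
    then show ?thesis using ce by simp
  qed

  \<comment> \<open>A version of \<open>Z\<close> all of whose paths lie in the span.\<close>
  define W where "W \<omega> = (\<lambda>t. \<Sum>e\<in>E. real_cond_exp M \<sigma>Y e \<omega> * \<Psi> e t)" for \<omega>
  have Z_eq: "AE \<omega> in M. Z t \<omega> = W \<omega> t" for t
  proof -
    have [measurable]: "f \<in> borel_measurable M" if "f \<in> E" for f
      using EL[OF that] by (rule square_integrable_measurable)
    have "AE \<omega> in M. Z t \<omega> = real_cond_exp M \<sigma>Y (X t) \<omega>"
      using Z_version by (simp add: cond_exp_version_def)
    moreover have "AE \<omega> in M. real_cond_exp M \<sigma>Y (X t) \<omega> =
        real_cond_exp M \<sigma>Y (real_cond_exp M \<sigma>\<xi> (X t)) \<omega>"
      by (rule cond_indep_tower[OF subY subX sub\<xi> cond_independent square_integrable_integrable[OF XL]])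
        (simp add: \<sigma>X_def gen_subalgebra_measurable)
    moreover have "AE \<omega> in M. real_cond_exp M \<sigma>Y (real_cond_exp M \<sigma>\<xi> (X t)) \<omega> =
        real_cond_exp M \<sigma>Y (\<lambda>\<omega>. \<Sum>e\<in>E. \<Psi> e t * e \<omega>) \<omega>"
      by (rule Y.real_cond_exp_cong[OF regression]) auto
    moreover have "AE \<omega> in M. real_cond_exp M \<sigma>Y (\<lambda>\<omega>. \<Sum>e\<in>E. \<Psi> e t * e \<omega>) \<omega> =
        (\<Sum>e\<in>E. \<Psi> e t * real_cond_exp M \<sigma>Y e \<omega>)"
      by (rule Y.real_cond_exp_lincomb) (rule square_integrable_integrable[OF EL])
    ultimately show ?thesis
      by eventually_elim (simp add: W_def mult.commute)
  qed

  have W_span: "W \<omega> \<in> fun_space.span ((\<lambda>i. \<Psi> (\<xi> i)) ` {1..p})" for \<omega>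
  proof -
    have "W \<omega> = (\<Sum>e\<in>E. (\<lambda>t. real_cond_exp M \<sigma>Y e \<omega> * \<Psi> e t))" by (auto simp: W_def sum_fun_apply)
    then show ?thesis
      using E_\<Psi> by (auto intro!: fun_space.span_sum fun_space.span_scale)
  qed

  have "AE \<omega> in M. (\<lambda>t. Z t \<omega>) = W \<omega>"
    using countable_or_continuous
  proof (elim disjE conjE)
    assume "countable (UNIV :: 't set)"
    then have "AE \<omega> in M. \<forall>t\<in>UNIV. Z t \<omega> = W \<omega> t"
      using Z_eq by (subst AE_ball_countable) auto
    then show ?thesis by eventually_elim auto
  next
    assume R: "continuous_on UNIV (\<lambda>(s, t). R s t)"
      and paths: "AE \<omega> in M. continuous_on UNIV (\<lambda>t. Z t \<omega>)"
    obtain D :: "'t set" where D: "countable D" "closure D = UNIV"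
      using separable by (rule separable_space_euclidean_dense)
    have agree: "AE \<omega> in M. \<forall>t\<in>D. Z t \<omega> = W \<omega> t"
      using Z_eq D(1) by (subst AE_ball_countable) auto
    have "continuous_on UNIV (\<Psi> e)" if "e \<in> E" for e
      using Loeve E_mem[OF that] unfolding loeve_isometry_def
      by (intro rkhs_continuous_on[OF RKHS R]) blast
    then have W_cont: "continuous_on UNIV (W \<omega>)" for \<omega>
      unfolding W_def by (intro continuous_intros) auto
    from agree paths show ?thesis
    proof eventually_elim
      case (elim \<omega>)
      show ?case
        by (rule continuous_eq_on_dense[OF elim(2) W_cont D(2)]) (use elim(1) in auto)
    qed
  qed
  then show ?thesis
    by eventually_elim (simp only: W_span)
qed

end
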